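(* Let $C_{132}(x,p,q,r)=\sum_{n\geq0}x^n\sum_{\sigma\in\mathcal{Q}_n(132)}p^{\mathrm{plat}(\sigma)}q^{\mathrm{des}(\sigma)}r^{\mathrm{asc}(\sigma)}$, a formal power series in $x$. Then $f=q\,C_{132}(x,p,q,r)-q+1$ satisfies $$f=1+px\Big(q-2r+r\big(2+(pr-pq+q^2)x\big)f-pr^2xf^2\Big)f.$$
   Context: A Stirling permutation of order $n$ is a permutation $\sigma=\sigma_1\cdots\sigma_{2n}$ of the multiset $\{1,1,2,2,\ldots,n,n\}$ such that, for each $i\in[n]$, every entry between the two occurrences of $i$ is greater than $i$; $\mathcal{Q}_n$ is the set of these ($\mathcal{Q}_0$ consists of the empty word). For $\sigma\in\mathcal{Q}_n$: $\mathrm{des}(\sigma)$, $\mathrm{asc}(\sigma)$, $\mathrm{plat}(\sigma)$ are the numbers of $i\in\{1,\dots,2n-1\}$ with $\sigma_i>\sigma_{i+1}$, $\sigma_i<\sigma_{i+1}$, $\sigma_i=\sigma_{i+1}$ respectively. $\mathcal{Q}_n(132)$ is the set of $\sigma\in\mathcal{Q}_n$ with no subsequence $\sigma_{i_1}\sigma_{i_2}\sigma_{i_3}$ ($i_1<i_2<i_3$) satisfying $\sigma_{i_1}<\sigma_{i_3}<\sigma_{i_2}$. *)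

theory Defs
  imports "HOL-Library.Multiset" "HOL-Computational_Algebra.Formal_Power_Series"
begin

text \<open>Words are lists of naturals; list positions are 0-based.\<close>

definition stirling_perms :: "nat \<Rightarrow> nat list set" where
  "stirling_perms n =
     {xs. mset xs = (\<Sum>i\<in>{1..n}. replicate_mset 2 i) \<and>
          (\<forall>a b c. a < b \<and> b < c \<and> c < length xs \<and> xs ! a = xs ! c \<longrightarrow> xs ! a < xs ! b)}"

definition avoids_132 :: "nat list \<Rightarrow> bool" where
  "avoids_132 xs \<longleftrightarrow>
     \<not> (\<exists>a b c. a < b \<and> b < c \<and> c < length xs \<and> xs ! a < xs ! c \<and> xs ! c < xs ! b)"

definition stirling_perms_132 :: "nat \<Rightarrow> nat list set" where
  "stirling_perms_132 n = {xs \<in> stirling_perms n. avoids_132 xs}"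

definition des :: "nat list \<Rightarrow> nat" where
  "des xs = card {i. Suc i < length xs \<and> xs ! i > xs ! Suc i}"

definition asc :: "nat list \<Rightarrow> nat" where
  "asc xs = card {i. Suc i < length xs \<and> xs ! i < xs ! Suc i}"

definition plat :: "nat list \<Rightarrow> nat" where
  "plat xs = card {i. Suc i < length xs \<and> xs ! i = xs ! Suc i}"

text \<open>
  The weights \<open>p\<close>, \<open>q\<close>, \<open>r\<close> range over an arbitrary commutative ring; taking a polynomial ring
  over the integers and its variables gives the case of indeterminate weights.
\<close>

definition C_132 :: "'a::comm_ring_1 \<Rightarrow> 'a \<Rightarrow> 'a \<Rightarrow> 'a fps" where
  "C_132 p q r =
     Abs_fps (\<lambda>n. \<Sum>xs\<in>stirling_perms_132 n. p ^ plat xs * q ^ des xs * r ^ asc xs)"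

lemma finite_stirling_perms: "finite (stirling_perms n)"
proof -
  let ?M = "\<Sum>i\<in>{1..n}. replicate_mset 2 i"
  have "stirling_perms n \<subseteq> {xs. set xs \<subseteq> set_mset ?M \<and> length xs = size ?M}"
    by (auto simp: stirling_perms_def simp flip: set_mset_mset size_mset)
  then show ?thesis
    by (rule finite_subset) (rule finite_lists_length_eq, rule finite_set_mset)
qed

lemma finite_stirling_perms_132: "finite (stirling_perms_132 n)"
  by (simp add: stirling_perms_132_def finite_stirling_perms)

end

theory Submission
  imports Defs
begin

text \<open>
  Split a word by its last letter \<open>l\<close>. Avoiding 132 forces all letters greater than \<open>l\<close> to precede
  all letters smaller than \<open>l\<close>, so a word with doubled letters is either \<open>u @ v @ [l, l]\<close> with
  \<open>u > l > v\<close>, or \<open>w @ [l]\<close> where \<open>l\<close> is the minimum, occurring once in \<open>w\<close> but not at its end.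
  Words whose minimum occurs once split in the same way: they are \<open>u @ [l]\<close> with \<open>l\<close> the minimum,
  or \<open>u @ v @ [l, l]\<close> with \<open>v\<close> again of this kind. If \<open>F = C - 1\<close> and \<open>G\<close> is the generating
  function of the second kind of words, not counting the minimum in the exponent of \<open>x\<close>, this gives
  \<open>G = f + T\<close>, \<open>T = r p x f G\<close> and \<open>F = x (p f (1 + r F) + q T)\<close> with \<open>f = 1 + q F\<close>;
  eliminating \<open>T\<close> and \<open>G\<close> yields the cubic equation.
\<close>

section \<open>The two forbidden configurations, read from the last letter\<close>

text \<open>No multiset is prescribed, because the blocks of a split word use other sets of letters
  and may contain their minimum only once.\<close>

definition stirling_132 :: "nat list \<Rightarrow> bool" where
  "stirling_132 xs \<longleftrightarrow>
     (\<forall>a b c. a < b \<and> b < c \<and> c < length xs \<and> xs ! a = xs ! c \<longrightarrow> xs ! a < xs ! b) \<and> avoids_132 xs"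

text \<open>\<open>may_precede l x y\<close>: the letters \<open>x, y, l\<close>, in this order, violate neither condition.\<close>

definition may_precede :: "nat \<Rightarrow> nat \<Rightarrow> nat \<Rightarrow> bool" where
  "may_precede l x y \<longleftrightarrow> (x = l \<longrightarrow> l < y) \<and> (x < l \<longrightarrow> y \<le> l)"

lemma stirling_132_Nil [simp]: "stirling_132 []"
  by (simp add: stirling_132_def avoids_132_def)

text \<open>A violation in \<open>w @ [l]\<close> that is not already in \<open>w\<close> has the
  new \<open>l\<close> as its third letter, so the extra condition concerns only pairs of letters of
  \<open>w\<close>.\<close>

lemma stirling_132_snoc:
  "stirling_132 (w @ [l]) \<longleftrightarrow> stirling_132 w \<and> sorted_wrt (may_precede l) w"
proof -
  \<comment> \<open>Both conditions forbid triples of positions and are treated as one: the first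
    disjunct violates the Stirling condition, the second is the pattern 132.\<close>
  let ?bad = "\<lambda>xs a b c. xs ! a = xs ! c \<and> \<not> xs ! a < xs ! b \<or> xs ! a < xs ! c \<and> xs ! c < (xs ! b :: nat)"
  have iff: "stirling_132 xs \<longleftrightarrow> (\<forall>c<length xs. \<forall>b<c. \<forall>a<b. \<not> ?bad xs a b c)" for xs
    unfolding stirling_132_def avoids_132_def by (auto; blast)
  have "stirling_132 (w @ [l]) \<longleftrightarrow> stirling_132 w \<and>
    (\<forall>b<length w. \<forall>a<b. \<not> ?bad (w @ [l]) a b (length w))"
    unfolding iff by (auto simp: All_less_Suc nth_append)
  also have "(\<forall>b<length w. \<forall>a<b. \<not> ?bad (w @ [l]) a b (length w)) \<longleftrightarrow> sorted_wrt (may_precede l) w"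
  proof -
    have "\<not> ?bad (w @ [l]) a b (length w) \<longleftrightarrow> may_precede l (w ! a) (w ! b)"
      if "a < b" "b < length w" for a b
      using that by (auto simp: nth_append may_precede_def not_less)
    then show ?thesis unfolding sorted_wrt_iff_nth_less by blast
  qed
  finally show ?thesis .
qed

lemma sorted_wrt_may_precedeI:
  assumes "(\<forall>x\<in>set w. l < x) \<or> (\<forall>x\<in>set w. x < l)"
  shows "sorted_wrt (may_precede l) w"
  using assms by (induction w) (auto simp: may_precede_def)

text \<open>In a forbidden triple the first letter is at most the third, so none can start in
  \<open>xs\<close> and end in \<open>ys\<close>.\<close>

lemma stirling_132_append_greater:
  assumes "\<forall>x\<in>set xs. \<forall>y\<in>set ys. y < x"
  shows "stirling_132 (xs @ ys) \<longleftrightarrow> stirling_132 xs \<and> stirling_132 ys"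
  using assms
proof (induction ys rule: rev_induct)
  case (snoc y ys)
  have "sorted_wrt (may_precede y) xs"
    using snoc.prems by (intro sorted_wrt_may_precedeI) auto
  moreover have "may_precede y x z" if "x \<in> set xs" for x z
    using snoc.prems that by (fastforce simp: may_precede_def)
  ultimately show ?case using snoc
    unfolding append_assoc[symmetric] stirling_132_snoc by (auto simp: sorted_wrt_append)
qed simp

text \<open>After a letter below \<open>l\<close> only letters at most \<open>l\<close> are allowed,
  hence only smaller ones, as \<open>l\<close> itself is absent. So the letters above
  \<open>l\<close> come first.\<close>

lemma sorted_wrt_may_precede_iff:
  assumes "l \<notin> set w"
  shows "sorted_wrt (may_precede l) w \<longleftrightarrow>
    (\<exists>u v. w = u @ v \<and> (\<forall>x\<in>set u. l < x) \<and> (\<forall>x\<in>set v. x < l))"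
proof
  assume "sorted_wrt (may_precede l) w"
  then show "\<exists>u v. w = u @ v \<and> (\<forall>x\<in>set u. l < x) \<and> (\<forall>x\<in>set v. x < l)"
    using assms
  proof (induction w)
    case (Cons a w)
    show ?case
    proof (cases "a < l")
      case True
      then have "\<forall>x\<in>set (a # w). x < l"
        using Cons.prems by (auto simp: may_precede_def le_less)
      then show ?thesis by (intro exI[of _ "[]"] exI[of _ "a # w"]) auto
    next
      case False
      obtain u v where "w = u @ v" "\<forall>x\<in>set u. l < x" "\<forall>x\<in>set v. x < l"
        using Cons by auto
      then show ?thesis using False Cons.prems
        by (intro exI[of _ "a # u"] exI[of _ v]) auto
    qed
  qed simp
next
  assume "\<exists>u v. w = u @ v \<and> (\<forall>x\<in>set u. l < x) \<and> (\<forall>x\<in>set v. x < l)"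
  then obtain u v where w: "w = u @ v" "\<forall>x\<in>set u. l < x" "\<forall>x\<in>set v. x < l" by blast
  have "sorted_wrt (may_precede l) u" "sorted_wrt (may_precede l) v"
    using w by (simp_all add: sorted_wrt_may_precedeI)
  then show "sorted_wrt (may_precede l) w"
    using w by (fastforce simp: sorted_wrt_append may_precede_def)
qed

text \<open>The first of the two final letters adds no constraint: \<open>may_precede l x l\<close>
  holds for every \<open>x\<close> other than \<open>l\<close>. What remains is the block form of
  \<open>w\<close>, and the condition on \<open>w\<close> splits over its blocks.\<close>

lemma stirling_132_doubled_last:
  assumes "l \<notin> set w"
  shows "stirling_132 (w @ [l, l]) \<longleftrightarrow> (\<exists>u v. w = u @ v \<and> (\<forall>x\<in>set u. l < x) \<and> (\<forall>x\<in>set v. x < l) \<and>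
    stirling_132 u \<and> stirling_132 v)"
proof -
  have "sorted_wrt (may_precede l) (w @ [l]) \<longleftrightarrow> sorted_wrt (may_precede l) w"
    using assms by (auto simp: sorted_wrt_append may_precede_def)
  moreover have "w @ [l, l] = (w @ [l]) @ [l]" by simp
  ultimately have "stirling_132 (w @ [l, l]) \<longleftrightarrow> stirling_132 w \<and> sorted_wrt (may_precede l) w"
    using stirling_132_snoc by metis
  moreover have "stirling_132 (u @ v) \<longleftrightarrow> stirling_132 u \<and> stirling_132 v"
    if "\<forall>x\<in>set u. l < x" "\<forall>x\<in>set v. x < l" for u v
    using that by (intro stirling_132_append_greater) (blast intro: less_trans)
  ultimately show ?thesis
    unfolding sorted_wrt_may_precede_iff[OF assms] by blast
qed

text \<open>Letters of \<open>y\<close> lie between two copies of \<open>l\<close> and so exceed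
  \<open>l\<close>. A letter below \<open>l\<close> in \<open>x\<close>, a letter of
  \<open>y\<close> and the final \<open>l\<close> would then form a 132, so \<open>l\<close> is the
  minimum.\<close>

lemma stirling_132_split_last:
  assumes "l \<notin> set x" "l \<notin> set y" "y \<noteq> []"
  shows "stirling_132 (x @ l # y @ [l]) \<longleftrightarrow> stirling_132 (x @ l # y) \<and> (\<forall>z\<in>set (x @ y). l < z)"
proof -
  have "sorted_wrt (may_precede l) (x @ l # y) \<longleftrightarrow> (\<forall>z\<in>set (x @ y). l < z)"
  proof
    assume s: "sorted_wrt (may_precede l) (x @ l # y)"
    then have y: "\<forall>z\<in>set y. l < z" by (auto simp: sorted_wrt_append may_precede_def)
    moreover obtain z where "z \<in> set y" using assms(3) by (cases y) auto
    ultimately have "\<forall>z\<in>set x. l < z"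
      using s assms(1) by (fastforce simp: sorted_wrt_append may_precede_def)
    with y show "\<forall>z\<in>set (x @ y). l < z" by auto
  next
    assume *: "\<forall>z\<in>set (x @ y). l < z"
    have "sorted_wrt (may_precede l) x" "sorted_wrt (may_precede l) y"
      using * by (simp_all add: sorted_wrt_may_precedeI)
    moreover have "may_precede l z t" if "l < z" for z t
      using that by (simp add: may_precede_def)
    moreover have "may_precede l l t" if "l < t" for t
      using that by (simp add: may_precede_def)
    ultimately show "sorted_wrt (may_precede l) (x @ l # y)"
      using * by (auto simp: sorted_wrt_append)
  qed
  then show ?thesis using stirling_132_snoc[of "x @ l # y" l] by simp
qed

section \<open>Words with prescribed multiplicities and their splittings\<close>

text \<open>With multiplicities given by a function, the blocks above and below a letter arise by
  restricting \<open>c\<close> pointwise.\<close>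

definition words :: "(nat \<Rightarrow> nat) \<Rightarrow> nat list set" where
  "words c = {w. stirling_132 w \<and> (\<forall>x. count (mset w) x = c x)}"

text \<open>The start \<open>a\<close> is a parameter since the upper block of a split word does not
  use an initial segment of the letters.\<close>

abbreviation doubled :: "nat \<Rightarrow> nat \<Rightarrow> nat \<Rightarrow> nat" where
  "doubled a n \<equiv> \<lambda>x. if a \<le> x \<and> x < a + n then 2 else 0"

text \<open>Only the doubled letters are counted by \<open>n\<close>, which will be the exponent of
  the series variable.\<close>

abbreviation doubled_above :: "nat \<Rightarrow> nat \<Rightarrow> nat \<Rightarrow> nat" where
  "doubled_above a n \<equiv> \<lambda>x. if x = a then 1 else if a < x \<and> x \<le> a + n then 2 else 0"

lemma set_words: "w \<in> words c \<Longrightarrow> x \<in> set w \<longleftrightarrow> c x \<noteq> 0"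
  by (metis (mono_tags, lifting) count_eq_zero_iff mem_Collect_eq set_mset_mset words_def)

lemma finite_words: "finite (words c)"
proof (cases "words c = {}")
  case False
  then obtain w where "w \<in> words c" by blast
  then have "words c \<subseteq> {v. mset v = mset w}"
    by (auto simp: words_def multiset_eq_iff)
  then show ?thesis by (rule finite_subset) (rule mset_eq_finite)
qed simp

lemma words_doubled_0: "words (doubled a 0) = {[]}"
proof -
  have "w = []" if "w \<in> words (doubled a 0)" for w
    using set_words[OF that] by (cases w) (fastforce split: if_splits)+
  then show ?thesis by (auto simp: words_def)
qed

lemma Nil_in_words_doubled_iff: "[] \<in> words (doubled a n) \<longleftrightarrow> n = 0"
proof
  assume "[] \<in> words (doubled a n)"
  then have "doubled a n a = 0" using set_words by fastforce
  then show "n = 0" by (simp split: if_splits)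
qed (simp add: words_def)

lemma Nil_notin_words_doubled_above: "[] \<notin> words (doubled_above a n)"
  using set_words[of "[]" "doubled_above a n" a] by auto

definition ending_doubled :: "nat \<Rightarrow> nat list set" where
  "ending_doubled l = {w. \<exists>v. w = v @ [l, l]}"

text \<open>A general \<open>c\<close> lets one splitting serve both \<open>doubled\<close> and
  \<open>doubled_above\<close>.\<close>

lemma words_ending_doubled:
  assumes "c l = 2"
  shows "words c \<inter> ending_doubled l =
    (\<lambda>(u, v). u @ v @ [l, l]) `
      (words (\<lambda>x. if l < x then c x else 0) \<times> words (\<lambda>x. if x < l then c x else 0))"
    (is "_ = _ ` (?U \<times> ?V)")
proof (intro set_eqI iffI)
  fix w assume w: "w \<in> words c \<inter> ending_doubled l"
  then obtain z where z: "w = z @ [l, l]" by (auto simp: ending_doubled_def)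
  have c: "c x = count (mset z) x + (if x = l then 2 else 0)" for x
  proof -
    have "c x = count (mset w) x" using w by (simp add: words_def)
    then show ?thesis by (simp add: z)
  qed
  then have "l \<notin> set z" using assms c[of l] by (simp add: count_eq_zero_iff)
  moreover have "stirling_132 (z @ [l, l])" using w by (auto simp: words_def z)
  ultimately obtain u v where uv: "z = u @ v" "\<forall>x\<in>set u. l < x" "\<forall>x\<in>set v. x < l"
    "stirling_132 u" "stirling_132 v"
    by (auto simp: stirling_132_doubled_last)
  have u0: "count (mset u) x = 0" if "\<not> l < x" for x
    using that uv by (auto simp: count_eq_zero_iff)
  have v0: "count (mset v) x = 0" if "\<not> x < l" for x
    using that uv by (auto simp: count_eq_zero_iff)
  have "u \<in> ?U" "v \<in> ?V"
    using uv u0 v0 by (auto simp: words_def c)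
  then show "w \<in> (\<lambda>(u, v). u @ v @ [l, l]) ` (?U \<times> ?V)" using z uv by auto
next
  fix w assume "w \<in> (\<lambda>(u, v). u @ v @ [l, l]) ` (?U \<times> ?V)"
  then obtain u v where w: "w = (u @ v) @ [l, l]" and u: "u \<in> ?U" and v: "v \<in> ?V" by auto
  have "\<forall>x\<in>set u. l < x" "\<forall>x\<in>set v. x < l"
    using set_words[OF u] set_words[OF v] by (auto split: if_splits)
  moreover from this have "l \<notin> set (u @ v)" by auto
  moreover have "stirling_132 u" "stirling_132 v" using u v by (auto simp: words_def)
  ultimately have "stirling_132 w" unfolding w by (subst stirling_132_doubled_last) blast+
  moreover have "count (mset w) x = c x" for x
    using u v assms by (auto simp: w words_def)
  ultimately show "w \<in> words c \<inter> ending_doubled l" by (auto simp: w words_def ending_doubled_def)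
qed

text \<open>Both blocks are recovered from the joined word by filtering for the letters above and
  below \<open>l\<close>.\<close>

lemma inj_on_join_doubled:
  "inj_on (\<lambda>(u, v). u @ v @ [l, l])
    (words (\<lambda>x. if l < x then c x else 0) \<times> words (\<lambda>x. if x < l then c x else 0))"
    (is "inj_on ?j (?U \<times> ?V)")
proof (rule inj_on_inverseI)
  fix z assume "z \<in> ?U \<times> ?V"
  then obtain u v where z: "z = (u, v)" and u: "u \<in> ?U" and v: "v \<in> ?V" by auto
  have "\<forall>x\<in>set u. l < x" "\<forall>x\<in>set v. x < l"
    using set_words[OF u] set_words[OF v] by (auto split: if_splits)
  then have "filter (\<lambda>x. l < x) (u @ v @ [l, l]) = u" "filter (\<lambda>x. x < l) (u @ v @ [l, l]) = v"
    by (auto simp: filter_id_conv filter_empty_conv)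
  then show "(\<lambda>w. (filter (\<lambda>x. l < x) w, filter (\<lambda>x. x < l) w)) (?j z) = z"
    by (simp add: z)
qed

lemma words_last_twiceE:
  assumes "w \<in> words c" "w \<noteq> []" "last w = l" "c l = 2"
  obtains x y where "w = x @ l # y @ [l]" "l \<notin> set x" "l \<notin> set y"
proof -
  have w: "w = butlast w @ [l]" using assms by auto
  have c: "count (mset (butlast w)) l = 1"
    using assms(1,4) arg_cong[OF w, of "\<lambda>w. count (mset w) l"] by (auto simp: words_def)
  then have "l \<in> set (butlast w)" by (metis count_mset_0_iff zero_neq_one)
  then obtain x y where xy: "butlast w = x @ l # y" "l \<notin> set x" by (meson split_list_first)
  with c have "count (mset y) l = 0" by auto
  then have "l \<notin> set y" by (simp add: count_eq_zero_iff)
  with that xy w show thesis by (metis append_assoc append_Cons)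
qed

text \<open>These words have generating function \<open>T\<close> in the overview. They occur among
  the words with a single minimum and, extended by a second \<open>a\<close>, among the words with
  doubled letters.\<close>

definition words_not_ending_min :: "nat \<Rightarrow> nat \<Rightarrow> nat list set" where
  "words_not_ending_min a n = {w \<in> words (doubled_above a n). last w \<noteq> a}"

lemma words_doubled_above_eq:
  "words (doubled_above a n) =
    (\<lambda>w. w @ [a]) ` words (doubled (Suc a) n) \<union> words_not_ending_min a n"
proof (intro set_eqI iffI)
  fix w assume w: "w \<in> words (doubled_above a n)"
  show "w \<in> (\<lambda>w. w @ [a]) ` words (doubled (Suc a) n) \<union> words_not_ending_min a n"
  proof (cases "last w = a")
    case True
    moreover have "w \<noteq> []" using w Nil_notin_words_doubled_above by blast
    ultimately obtain v where v: "w = v @ [a]" by (metis append_butlast_last_id)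
    have "v \<in> words (doubled (Suc a) n)"
    proof -
      have "count (mset v) x = doubled (Suc a) n x" for x
      proof -
        have "count (mset w) x = doubled_above a n x" using w by (simp add: words_def)
        then show ?thesis by (auto simp: v Suc_le_eq split: if_splits)
      qed
      then show ?thesis using w by (simp add: words_def v stirling_132_snoc)
    qed
    then show ?thesis using v by auto
  qed (use w in \<open>simp add: words_not_ending_min_def\<close>)
next
  fix w assume "w \<in> (\<lambda>w. w @ [a]) ` words (doubled (Suc a) n) \<union> words_not_ending_min a n"
  moreover have "v @ [a] \<in> words (doubled_above a n)" if v: "v \<in> words (doubled (Suc a) n)" for v
  proof -
    have "\<forall>x\<in>set v. a < x" using set_words[OF v] by (auto split: if_splits)
    then show ?thesis using v
      by (auto simp: words_def stirling_132_snoc sorted_wrt_may_precedeI)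
  qed
  ultimately show "w \<in> words (doubled_above a n)" by (auto simp: words_not_ending_min_def)
qed

text \<open>The last letter exceeds \<open>a\<close> and so occurs twice. If its copies were not
  adjacent, it would be the minimum by \<open>stirling_132_split_last\<close>, which is impossible
  beside \<open>a\<close>.\<close>

lemma words_not_ending_min_eq:
  "words_not_ending_min a n =
    (\<Union>k<n. words (doubled_above a n) \<inter> ending_doubled (Suc (a + k)))"
proof (intro set_eqI iffI)
  fix w assume "w \<in> words_not_ending_min a n"
  then have w: "w \<in> words (doubled_above a n)" and "last w \<noteq> a"
    by (auto simp: words_not_ending_min_def)
  define l where "l = last w"
  have ne: "w \<noteq> []" using w Nil_notin_words_doubled_above by blast
  then have "doubled_above a n l \<noteq> 0" using set_words[OF w, of l] by (simp add: l_def)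
  then have l: "a < l" "l \<le> a + n" using \<open>last w \<noteq> a\<close> by (auto simp: l_def split: if_splits)
  then have "doubled_above a n l = 2" by simp
  then obtain x y where xy: "w = x @ l # y @ [l]" "l \<notin> set x" "l \<notin> set y"
    using words_last_twiceE[OF w ne] l_def by metis
  have "a \<in> set (x @ y)" using set_words[OF w, of a] l by (auto simp: xy)
  moreover have "stirling_132 (x @ l # y @ [l])" using w by (simp add: words_def xy(1))
  ultimately have "y = []"
    using stirling_132_split_last[OF xy(2,3)] l(1) less_asym by blast
  \<comment> \<open>The index \<open>l - Suc a\<close> is the number of doubled letters below
    \<open>l\<close>.\<close>
  then have "w \<in> ending_doubled (Suc (a + (l - Suc a)))"
    using xy l by (auto simp: ending_doubled_def)
  moreover have "l - Suc a < n" using l by auto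
  ultimately show "w \<in> (\<Union>k<n. words (doubled_above a n) \<inter> ending_doubled (Suc (a + k)))"
    using w by blast
qed (auto simp: words_not_ending_min_def ending_doubled_def)

text \<open>If the two copies of the last letter are not adjacent, that letter is the minimum
  \<open>a\<close>; deleting the final copy leaves a word with a single \<open>a\<close>, not at its
  end.\<close>

lemma words_doubled_Suc_eq:
  "words (doubled a (Suc n)) =
    (\<Union>k\<le>n. words (doubled a (Suc n)) \<inter> ending_doubled (a + k)) \<union>
    (\<lambda>w. w @ [a]) ` words_not_ending_min a n"
proof (intro set_eqI iffI)
  fix w assume w: "w \<in> words (doubled a (Suc n))"
  define l where "l = last w"
  have ne: "w \<noteq> []" using w Nil_in_words_doubled_iff by blast
  then have "doubled a (Suc n) l \<noteq> 0" using set_words[OF w, of l] by (simp add: l_def)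
  then have l: "a \<le> l" "l \<le> a + n" by (auto split: if_splits)
  then have "doubled a (Suc n) l = 2" by simp
  then obtain x y where xy: "w = x @ l # y @ [l]" "l \<notin> set x" "l \<notin> set y"
    using words_last_twiceE[OF w ne] l_def by metis
  show "w \<in> (\<Union>k\<le>n. words (doubled a (Suc n)) \<inter> ending_doubled (a + k)) \<union>
    (\<lambda>w. w @ [a]) ` words_not_ending_min a n"
  proof (cases "y = []")
    case True
    then have "w \<in> ending_doubled (a + (l - a))" "l - a \<le> n"
      using xy l by (auto simp: ending_doubled_def)
    with w show ?thesis by blast
  next
    case False
    have s: "stirling_132 (x @ l # y)" "\<forall>z\<in>set (x @ y). l < z"
      using stirling_132_split_last[OF xy(2,3) False] w by (auto simp: words_def xy(1))
    have "a \<in> set w" using set_words[OF w, of a] by simp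
    then have "a \<in> set (x @ y) \<or> l = a" by (auto simp: xy(1))
    then have "l = a" using s(2) l(1) leD by blast
    have "x @ l # y \<in> words (doubled_above a n)"
    proof -
      have "count (mset (x @ l # y)) z = doubled_above a n z" for z
      proof -
        have "count (mset w) z = doubled a (Suc n) z" using w by (simp add: words_def)
        then show ?thesis by (auto simp: xy(1) \<open>l = a\<close> split: if_splits)
      qed
      then show ?thesis using s(1) by (simp add: words_def)
    qed
    moreover have "last (x @ l # y) \<noteq> a" using False xy(3) \<open>l = a\<close> by auto
    ultimately show ?thesis
      using xy(1) \<open>l = a\<close> by (force simp: words_not_ending_min_def)
  qed
next
  fix w assume "w \<in> (\<Union>k\<le>n. words (doubled a (Suc n)) \<inter> ending_doubled (a + k)) \<union>
    (\<lambda>w. w @ [a]) ` words_not_ending_min a n"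
  moreover have "v @ [a] \<in> words (doubled a (Suc n))" if "v \<in> words_not_ending_min a n" for v
  proof -
    have v: "v \<in> words (doubled_above a n)" "last v \<noteq> a"
      using that by (auto simp: words_not_ending_min_def)
    have c: "count (mset v) z = doubled_above a n z" for z using v by (simp add: words_def)
    have "a \<in> set v" using set_words[OF v(1), of a] by simp
    then obtain x y where xy: "v = x @ a # y" "a \<notin> set x" by (meson split_list_first)
    have "count (mset y) a = 0" using c[of a] xy by simp
    then have ya: "a \<notin> set y" by (simp add: count_eq_zero_iff)
    have "y \<noteq> []" using v(2) xy by auto
    have "z > a" if "z \<in> set (x @ y)" for z
    proof -
      have "z \<noteq> a" using that xy ya by auto
      moreover have "z \<in> set v" using that xy by auto
      ultimately show ?thesis using set_words[OF v(1), of z] by (auto split: if_splits)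
    qed
    then have "stirling_132 (v @ [a])"
      using stirling_132_split_last[OF xy(2) ya \<open>y \<noteq> []\<close>] v(1) by (simp add: words_def xy(1))
    then show ?thesis by (auto simp: words_def c)
  qed
  ultimately show "w \<in> words (doubled a (Suc n))" by auto
qed

section \<open>The three statistics as one multiplicative weight\<close>

text \<open>An arbitrary relation \<open>R\<close> covers plateaus, descents and ascents at
  once.\<close>

lemma card_adjacent_Cons:
  "card {i. Suc i < length (x # y # w) \<and> R ((x # y # w) ! i) ((x # y # w) ! Suc i)} =
    of_bool (R x y) + card {i. Suc i < length (y # w) \<and> R ((y # w) ! i) ((y # w) ! Suc i)}"
    (is "card ?A = _ + card ?B")
proof -
  have A: "?A = (if R x y then {0} else {}) \<union> Suc ` ?B"
  proof (rule set_eqI)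
    fix i show "i \<in> ?A \<longleftrightarrow> i \<in> (if R x y then {0} else {}) \<union> Suc ` ?B"
      by (cases i) auto
  qed
  have "finite ?B" by (rule finite_subset[of _ "{..<length (y # w)}"]) auto
  then have "card ?A = card (if R x y then {0::nat} else {}) + card (Suc ` ?B)"
    unfolding A by (intro card_Un_disjoint) auto
  then show ?thesis by (simp add: card_image)
qed

lemma stirling_perms_132_eq: "stirling_perms_132 n = words (doubled 1 n)"
proof -
  have "count (\<Sum>i\<in>{1..n}. replicate_mset 2 i) x = doubled 1 n x" for x
    by (simp add: count_sum if_distrib cong: if_cong)
  then have "mset w = (\<Sum>i\<in>{1..n}. replicate_mset 2 i) \<longleftrightarrow> (\<forall>x. count (mset w) x = doubled 1 n x)" for w
    by (simp only: multiset_eq_iff)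
  then show ?thesis
    unfolding stirling_perms_132_def stirling_perms_def words_def stirling_132_def by blast
qed

context
  fixes p q r :: "'a::comm_ring_1"
begin

text \<open>Reading adjacent pairs makes the weight multiplicative under concatenation, up to one
  factor at the junction.\<close>

fun weight :: "nat list \<Rightarrow> 'a" where
  "weight (x # y # w) = (if x = y then p else if y < x then q else r) * weight (y # w)"
| "weight w = 1"

lemma weight_eq: "weight w = p ^ plat w * q ^ des w * r ^ asc w"
proof (induction w rule: weight.induct)
  case (1 x y w)
  have "plat (x # y # w) = of_bool (x = y) + plat (y # w)"
    "des (x # y # w) = of_bool (y < x) + des (y # w)"
    "asc (x # y # w) = of_bool (x < y) + asc (y # w)"
    unfolding plat_def des_def asc_def
    by (rule card_adjacent_Cons[of _ _ _ "(=)"] card_adjacent_Cons[of _ _ _ "\<lambda>x y. y < x"]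
        card_adjacent_Cons[of _ _ _ "(<)"])+
  then show ?case using 1 by (auto simp: mult_ac)
qed (simp_all add: plat_def des_def asc_def)

lemma weight_append:
  assumes "u \<noteq> []" "v \<noteq> []"
  shows "weight (u @ v) = weight u * (if last u = hd v then p else if hd v < last u then q else r) * weight v"
  using assms
proof (induction u rule: weight.induct)
  case (1 x y u)
  then show ?case by (simp add: mult.assoc)
next
  case ("2_2" x)
  then show ?case by (cases v) auto
qed simp

lemma weight_append_less:
  assumes "\<forall>x\<in>set u. \<forall>y\<in>set v. y < x" "v \<noteq> []"
  shows "weight (u @ v) = (if u = [] then 1 else q * weight u) * weight v"
proof (cases "u = []")
  case False
  then have "hd v < last u" using assms by simp
  then show ?thesis using weight_append[OF False assms(2)] False by (simp add: mult_ac)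
qed simp

text \<open>The final pair is a plateau, \<open>v\<close> is left by an ascent to \<open>l\<close>,
  and \<open>u\<close> by a descent to \<open>v\<close> or, if \<open>v\<close> is empty, to
  \<open>l\<close>. An empty block has no junction and contributes 1.\<close>

lemma weight_join_doubled:
  assumes "\<forall>x\<in>set u. l < x" "\<forall>x\<in>set v. x < l"
  shows "weight (u @ v @ [l, l]) =
    p * ((if u = [] then 1 else q * weight u) * (if v = [] then 1 else r * weight v))"
proof -
  have v: "weight (v @ [l, l]) = p * (if v = [] then 1 else r * weight v)"
  proof (cases "v = []")
    case False
    then have "last v < l" using assms by simp
    then show ?thesis using weight_append[OF False, of "[l, l]"] False by (simp add: mult_ac)
  qed simp
  have "\<forall>x\<in>set u. \<forall>y\<in>set (v @ [l, l]). y < x" using assms by (auto intro: less_trans)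
  from weight_append_less[OF this] show ?thesis by (simp add: v mult_ac)
qed

lemma sum_weight_ending_doubled:
  assumes "c l = 2"
  shows "sum weight (words c \<inter> ending_doubled l) =
    p * ((\<Sum>u\<in>words (\<lambda>x. if l < x then c x else 0). if u = [] then 1 else q * weight u) *
         (\<Sum>v\<in>words (\<lambda>x. if x < l then c x else 0). if v = [] then 1 else r * weight v))"
    (is "_ = p * (sum ?f ?U * sum ?h ?V)")
proof -
  have "sum weight (words c \<inter> ending_doubled l) = (\<Sum>z\<in>?U \<times> ?V. weight (case z of (u, v) \<Rightarrow> u @ v @ [l, l]))"
    unfolding words_ending_doubled[of c, OF assms] by (subst sum.reindex[OF inj_on_join_doubled]) simp
  also have "\<dots> = (\<Sum>(u, v)\<in>?U \<times> ?V. p * (?f u * ?h v))"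
  proof (intro sum.cong refl, clarify)
    fix u v assume u: "u \<in> ?U" and v: "v \<in> ?V"
    have "\<forall>x\<in>set u. l < x" "\<forall>x\<in>set v. x < l"
      using set_words[OF u] set_words[OF v] by (auto split: if_splits)
    then show "weight (u @ v @ [l, l]) = p * (?f u * ?h v)" by (rule weight_join_doubled)
  qed
  also have "\<dots> = p * (sum ?f ?U * sum ?h ?V)"
    unfolding sum_product sum.cartesian_product by (simp add: sum_distrib_left case_prod_unfold)
  finally show ?thesis .
qed

section \<open>Recurrences for the weighted sums\<close>

definition weight_doubled :: "nat \<Rightarrow> nat \<Rightarrow> 'a" where
  "weight_doubled a n = sum weight (words (doubled a n))"

definition weight_above :: "nat \<Rightarrow> nat \<Rightarrow> 'a" where
  "weight_above a n = sum weight (words (doubled_above a n))"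

definition weight_not_ending_min :: "nat \<Rightarrow> nat \<Rightarrow> 'a" where
  "weight_not_ending_min a n = sum weight (words_not_ending_min a n)"

text \<open>The total weight of a block together with its junction factor \<open>z\<close>; the
  value 1 at \<open>n = 0\<close> belongs to the empty block, which has no junction.\<close>

definition scaled_weight :: "'a \<Rightarrow> nat \<Rightarrow> nat \<Rightarrow> 'a" where
  "scaled_weight z a n = (if n = 0 then 1 else z * weight_doubled a n)"

lemma scaled_weight_eq:
  "(\<Sum>w\<in>words (doubled a n). if w = [] then 1 else z * weight w) = scaled_weight z a n"
proof (cases "n = 0")
  case True
  then show ?thesis unfolding scaled_weight_def using words_doubled_0[of a] by simp
next
  case False
  then have "[] \<notin> words (doubled a n)" unfolding Nil_in_words_doubled_iff .
  then have "(\<Sum>w\<in>words (doubled a n). if w = [] then 1 else z * weight w) =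
      (\<Sum>w\<in>words (doubled a n). z * weight w)"
    by (intro sum.cong refl) metis
  then show ?thesis using False
    by (simp add: scaled_weight_def weight_doubled_def sum_distrib_left)
qed

lemma weight_doubled_0: "weight_doubled a 0 = 1"
  using words_doubled_0[of a] by (simp add: weight_doubled_def)

text \<open>Here \<open>k\<close> counts the doubled letters below the last letter
  \<open>Suc (a + k)\<close>, so \<open>n - Suc k\<close> letters lie above it.\<close>

lemma weight_not_ending_min_eq:
  "weight_not_ending_min a n =
    (\<Sum>k<n. r * p * (scaled_weight q (Suc (Suc (a + k))) (n - Suc k) * weight_above a k))"
proof -
  have "weight_not_ending_min a n =
      (\<Sum>k<n. sum weight (words (doubled_above a n) \<inter> ending_doubled (Suc (a + k))))"
    unfolding weight_not_ending_min_def words_not_ending_min_eq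
    by (rule sum.UNION_disjoint) (auto simp: finite_words ending_doubled_def)
  also have "\<dots> = (\<Sum>k<n. r * p * (scaled_weight q (Suc (Suc (a + k))) (n - Suc k) * weight_above a k))"
  proof (intro sum.cong refl)
    fix k assume "k \<in> {..<n}"
    then have k: "k < n" by simp
    let ?l = "Suc (a + k)"
    have U: "(\<lambda>x. if ?l < x then doubled_above a n x else 0) = doubled (Suc ?l) (n - Suc k)"
      using k by (intro ext) auto
    have V: "(\<lambda>x. if x < ?l then doubled_above a n x else 0) = doubled_above a k"
      using k by (intro ext) auto
    \<comment> \<open>The lower block contains the single minimum, so it is never empty and the
      ascent factor \<open>r\<close> is always present.\<close>
    have above: "(\<Sum>v\<in>words (doubled_above a k). if v = [] then 1 else r * weight v) = r * weight_above a k"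
      unfolding weight_above_def sum_distrib_left
      by (intro sum.cong refl) (metis Nil_notin_words_doubled_above)
    have l: "doubled_above a n ?l = 2" using k by simp
    show "sum weight (words (doubled_above a n) \<inter> ending_doubled ?l) =
        r * p * (scaled_weight q (Suc ?l) (n - Suc k) * weight_above a k)"
      using sum_weight_ending_doubled[of "doubled_above a n", OF l]
      unfolding U V scaled_weight_eq above by (simp only: mult_ac)
  qed
  finally show ?thesis .
qed

lemma weight_above_eq:
  "weight_above a n = scaled_weight q (Suc a) n + weight_not_ending_min a n"
proof -
  have "weight_above a n = sum weight ((\<lambda>w. w @ [a]) ` words (doubled (Suc a) n)) + weight_not_ending_min a n"
    unfolding weight_above_def weight_not_ending_min_def words_doubled_above_eq
    by (rule sum.union_disjoint) (auto simp: finite_words words_not_ending_min_def)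
  also have "sum weight ((\<lambda>w. w @ [a]) ` words (doubled (Suc a) n)) =
      (\<Sum>w\<in>words (doubled (Suc a) n). weight (w @ [a]))"
    by (subst sum.reindex) (auto simp: inj_on_def)
  also have "\<dots> = (\<Sum>w\<in>words (doubled (Suc a) n). if w = [] then 1 else q * weight w)"
  proof (intro sum.cong refl)
    fix w assume w: "w \<in> words (doubled (Suc a) n)"
    have "\<forall>x\<in>set w. \<forall>y\<in>set [a]. y < x" using set_words[OF w] by (auto split: if_splits)
    from weight_append_less[OF this] show "weight (w @ [a]) = (if w = [] then 1 else q * weight w)"
      by simp
  qed
  finally show ?thesis by (simp only: scaled_weight_eq)
qed

text \<open>The sum runs over the number \<open>k\<close> of letters below a doubled last letter. In
  the other case the appended minimum follows a larger letter, which gives the descent factor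
  \<open>q\<close>.\<close>

lemma weight_doubled_Suc:
  "weight_doubled a (Suc n) =
    (\<Sum>k\<le>n. p * (scaled_weight q (Suc (a + k)) (n - k) * scaled_weight r a k)) +
    q * weight_not_ending_min a n"
proof -
  let ?W = "words (doubled a (Suc n))"
  have "weight_doubled a (Suc n) =
      sum weight (\<Union>k\<le>n. ?W \<inter> ending_doubled (a + k)) +
      sum weight ((\<lambda>w. w @ [a]) ` words_not_ending_min a n)"
    unfolding weight_doubled_def
    by (subst words_doubled_Suc_eq, rule sum.union_disjoint)
      (auto simp: finite_words ending_doubled_def words_not_ending_min_def)
  also have "sum weight (\<Union>k\<le>n. ?W \<inter> ending_doubled (a + k)) =
      (\<Sum>k\<le>n. sum weight (?W \<inter> ending_doubled (a + k)))"
    by (rule sum.UNION_disjoint) (auto simp: finite_words ending_doubled_def)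
  also have "\<dots> = (\<Sum>k\<le>n. p * (scaled_weight q (Suc (a + k)) (n - k) * scaled_weight r a k))"
  proof (intro sum.cong refl)
    fix k assume "k \<in> {..n}"
    then have k: "k \<le> n" by simp
    have U: "(\<lambda>x. if a + k < x then doubled a (Suc n) x else 0) = doubled (Suc (a + k)) (n - k)"
      using k by (intro ext) auto
    have V: "(\<lambda>x. if x < a + k then doubled a (Suc n) x else 0) = doubled a k"
      using k by (intro ext) auto
    have l: "doubled a (Suc n) (a + k) = 2" using k by simp
    show "sum weight (?W \<inter> ending_doubled (a + k)) =
        p * (scaled_weight q (Suc (a + k)) (n - k) * scaled_weight r a k)"
      using sum_weight_ending_doubled[of "doubled a (Suc n)", OF l] unfolding U V scaled_weight_eq .
  qed
  also have "sum weight ((\<lambda>w. w @ [a]) ` words_not_ending_min a n) =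
      (\<Sum>w\<in>words_not_ending_min a n. weight (w @ [a]))"
    by (subst sum.reindex) (auto simp: inj_on_def)
  also have "\<dots> = q * weight_not_ending_min a n"
    unfolding weight_not_ending_min_def sum_distrib_left
  proof (intro sum.cong refl)
    fix w assume "w \<in> words_not_ending_min a n"
    then have w: "w \<in> words (doubled_above a n)" "last w \<noteq> a"
      by (auto simp: words_not_ending_min_def)
    then have ne: "w \<noteq> []" using Nil_notin_words_doubled_above by blast
    then have "a < last w" using set_words[OF w(1), of "last w"] w(2) by (auto split: if_splits)
    then show "weight (w @ [a]) = q * weight w"
      using weight_append[OF ne, of "[a]"] by (simp add: mult_ac)
  qed
  finally show ?thesis .
qed

text \<open>The recurrences determine the weighted sums without reference to \<open>a\<close>.\<close>

lemma weight_shift: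
  "weight_doubled a n = weight_doubled 1 n \<and> weight_above a n = weight_above 1 n"
proof (induction n arbitrary: a rule: less_induct)
  case (less n)
  have s: "scaled_weight z a k = scaled_weight z 1 k" if "k < n" for z a k
    using less.IH[OF that, of a] by (simp add: scaled_weight_def)
  have t: "weight_above a k = weight_above 1 k" if "k < n" for a k
    using less.IH[OF that] by blast
  \<comment> \<open>The case \<open>m = n\<close> is included: the recurrence refers only to indices
    below \<open>m\<close>, and \<open>weight_above\<close> at \<open>n\<close> needs it.\<close>
  have t': "weight_not_ending_min a m = weight_not_ending_min 1 m" if "m \<le> n" for a m
    unfolding weight_not_ending_min_eq
  proof (intro sum.cong refl)
    fix k assume k: "k \<in> {..<m}"
    have "scaled_weight q (Suc (Suc (a + k))) (m - Suc k) = scaled_weight q 1 (m - Suc k)"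
      "scaled_weight q (Suc (Suc (1 + k))) (m - Suc k) = scaled_weight q 1 (m - Suc k)"
      "weight_above a k = weight_above 1 k"
      by (rule s t; use that k in auto)+
    then show "r * p * (scaled_weight q (Suc (Suc (a + k))) (m - Suc k) * weight_above a k) =
      r * p * (scaled_weight q (Suc (Suc (1 + k))) (m - Suc k) * weight_above 1 k)"
      by simp
  qed
  have d: "weight_doubled a n = weight_doubled 1 n" for a
  proof (cases n)
    case (Suc m)
    have "(\<Sum>k\<le>m. p * (scaled_weight q (Suc (a + k)) (m - k) * scaled_weight r a k)) =
        (\<Sum>k\<le>m. p * (scaled_weight q (Suc (1 + k)) (m - k) * scaled_weight r 1 k))"
    proof (intro sum.cong refl)
      fix k assume k: "k \<in> {..m}"
      have "scaled_weight q (Suc (a + k)) (m - k) = scaled_weight q 1 (m - k)"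
        "scaled_weight q (Suc (1 + k)) (m - k) = scaled_weight q 1 (m - k)"
        "scaled_weight r a k = scaled_weight r 1 k"
        by (rule s; use k Suc in auto)+
      then show "p * (scaled_weight q (Suc (a + k)) (m - k) * scaled_weight r a k) =
          p * (scaled_weight q (Suc (1 + k)) (m - k) * scaled_weight r 1 k)"
        by simp
    qed
    then show ?thesis using t'[of m a] by (simp add: Suc weight_doubled_Suc)
  qed (simp add: weight_doubled_0)
  moreover have "weight_above a n = weight_above 1 n"
    unfolding weight_above_eq scaled_weight_def
    using t'[of n a] d[of "Suc a"] d[of "Suc 1"] by simp
  ultimately show ?case by blast
qed

lemma scaled_weight_shift: "scaled_weight z a n = scaled_weight z 1 n"
  using weight_shift[of a n] by (simp only: scaled_weight_def)

section \<open>Generating functions and their functional equations\<close>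

text \<open>In the notation of the overview, this series and the next two are \<open>G\<close>,
  \<open>T\<close> and \<open>1 + z F\<close>; the last one is \<open>f\<close> for
  \<open>z = q\<close>.\<close>

definition G_above :: "'a fps" where
  "G_above = Abs_fps (weight_above 1)"

definition G_not_ending_min :: "'a fps" where
  "G_not_ending_min = Abs_fps (weight_not_ending_min 1)"

definition G_scaled :: "'a \<Rightarrow> 'a fps" where
  "G_scaled z = Abs_fps (scaled_weight z 1)"

lemma C_132_nth: "fps_nth (C_132 p q r) n = weight_doubled 1 n"
  unfolding C_132_def weight_doubled_def stirling_perms_132_eq fps_nth_Abs_fps
  by (intro sum.cong refl weight_eq[symmetric])

lemma G_scaled_eq: "G_scaled z = 1 + fps_const z * (C_132 p q r - 1)"
  by (rule fps_ext) (simp add: G_scaled_def scaled_weight_def C_132_nth weight_doubled_0)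

lemma G_above_eq: "G_above = G_scaled q + G_not_ending_min"
proof (rule fps_ext)
  fix n
  have "weight_above 1 n = scaled_weight q 1 n + weight_not_ending_min 1 n"
    unfolding weight_above_eq scaled_weight_shift[of q "Suc 1"] ..
  then show "fps_nth G_above n = fps_nth (G_scaled q + G_not_ending_min) n"
    by (simp add: G_above_def G_scaled_def G_not_ending_min_def)
qed

text \<open>After shifting all blocks to start at 1, the recurrence is a Cauchy product;
  \<open>fps_X\<close> accounts for the doubled last letter.\<close>

lemma G_not_ending_min_eq:
  "G_not_ending_min = fps_const (r * p) * fps_X * (G_scaled q * G_above)"
proof (rule fps_ext)
  fix n
  show "fps_nth G_not_ending_min n = fps_nth (fps_const (r * p) * fps_X * (G_scaled q * G_above)) n"
  proof (cases n)
    case 0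
    then show ?thesis by (simp add: G_not_ending_min_def weight_not_ending_min_eq mult.assoc)
  next
    case (Suc m)
    have "fps_nth (G_scaled q * G_above) m = fps_nth (G_above * G_scaled q) m"
      by (simp add: mult.commute)
    also have "\<dots> = (\<Sum>k\<le>m. weight_above 1 k * scaled_weight q 1 (m - k))"
      by (simp add: fps_mult_nth atLeast0AtMost G_above_def G_scaled_def)
    finally have "fps_nth (fps_const (r * p) * fps_X * (G_scaled q * G_above)) n =
        r * p * (\<Sum>k\<le>m. weight_above 1 k * scaled_weight q 1 (m - k))"
      by (simp add: Suc mult.assoc)
    also have "\<dots> = weight_not_ending_min 1 n"
      unfolding weight_not_ending_min_eq Suc sum_distrib_left lessThan_Suc_atMost
      by (intro sum.cong refl)
        (metis diff_Suc_Suc mult.commute scaled_weight_shift)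
    finally show ?thesis by (simp add: G_not_ending_min_def)
  qed
qed

text \<open>In the first summand \<open>fps_X\<close> accounts for the doubled last letter, in the
  second for the minimum, which \<open>G_not_ending_min\<close> does not count.\<close>

lemma C_132_eq:
  "C_132 p q r = 1 + fps_X * (fps_const p * (G_scaled q * G_scaled r) + fps_const q * G_not_ending_min)"
proof (rule fps_ext)
  fix n
  show "fps_nth (C_132 p q r) n = fps_nth (1 + fps_X *
    (fps_const p * (G_scaled q * G_scaled r) + fps_const q * G_not_ending_min)) n"
  proof (cases n)
    case 0
    then show ?thesis by (simp add: C_132_nth weight_doubled_0)
  next
    case (Suc m)
    have "fps_nth (G_scaled q * G_scaled r) m = fps_nth (G_scaled r * G_scaled q) m"
      by (simp add: mult.commute)
    also have "\<dots> = (\<Sum>k\<le>m. scaled_weight r 1 k * scaled_weight q 1 (m - k))"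
      by (simp add: fps_mult_nth atLeast0AtMost G_scaled_def)
    finally have "p * fps_nth (G_scaled q * G_scaled r) m =
        (\<Sum>k\<le>m. p * (scaled_weight r 1 k * scaled_weight q 1 (m - k)))"
      by (simp only: sum_distrib_left)
    also have "\<dots> = (\<Sum>k\<le>m. p * (scaled_weight q (Suc (1 + k)) (m - k) * scaled_weight r 1 k))"
      by (intro sum.cong refl) (metis mult.commute scaled_weight_shift)
    finally have "p * fps_nth (G_scaled q * G_scaled r) m =
        (\<Sum>k\<le>m. p * (scaled_weight q (Suc (1 + k)) (m - k) * scaled_weight r 1 k))" .
    then show ?thesis
      by (simp add: Suc C_132_nth weight_doubled_Suc G_not_ending_min_def)
  qed
qed

end

section \<open>Elimination leading to the cubic equation\<close>

theorem theorem2p11: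
  fixes p q r :: "'a::comm_ring_1" and f :: "'a fps"
  assumes "f = fps_const q * C_132 p q r - fps_const q + 1"
  shows "f = 1 + fps_const p * fps_X *
    (fps_const (q - 2 * r)
      + fps_const r * (2 + fps_const (p * r - p * q + q ^ 2) * fps_X) * f
      - fps_const (p * r ^ 2) * fps_X * f ^ 2) * f"
proof -
  define P Q R x where "P = fps_const p" and "Q = fps_const q" and "R = fps_const r"
    and "x = (fps_X :: 'a fps)"
  define F G T where "F = C_132 p q r - 1" and "G = G_above p q r" and "T = G_not_ending_min p q r"
  have f: "f = 1 + Q * F" by (simp add: assms F_def Q_def algebra_simps)
  have q: "G_scaled p q r q = f" and r: "G_scaled p q r r = 1 + R * F"
    unfolding f by (simp_all add: G_scaled_eq F_def Q_def R_def)
  have G: "G = f + T"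
    using G_above_eq[of p q r] by (simp add: G_def T_def q)
  have T: "T = R * P * x * (f * G)"
    using G_not_ending_min_eq[of p q r]
    by (simp add: G_def T_def q R_def P_def x_def flip: fps_const_mult)
  have F: "F = x * (P * (f * (1 + R * F)) + Q * T)"
  proof -
    have "C_132 p q r = 1 + x * (P * (f * (1 + R * F)) + Q * T)"
      using C_132_eq[of p q r] unfolding q r T_def P_def Q_def x_def .
    then show ?thesis unfolding F_def by (rule iffD2[OF diff_eq_eq, OF trans[OF _ add.commute]])
  qed
  have QF: "Q * F = f - 1" using f by simp
  \<comment> \<open>Since \<open>f\<close> determines only \<open>Q * F\<close>, the equation for
    \<open>F\<close> is multiplied by \<open>Q\<close>; every \<open>F\<close> then occurs as
    \<open>Q * F\<close> and can be replaced by \<open>f - 1\<close>.\<close>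
  have "Q * F = Q * (x * (P * (f * (1 + R * F)) + Q * T))"
    by (rule arg_cong[OF F])
  also have "\<dots> = x * (P * f * (Q + R * (Q * F)) + Q ^ 2 * T)"
    by (simp add: algebra_simps power2_eq_square)
  finally have f1: "f - 1 = x * (P * f * (Q + R * (f - 1)) + Q ^ 2 * T)"
    unfolding QF .
  have T1: "T * (1 - R * P * x * f) = R * P * x * f ^ 2"
    using T unfolding G by (simp add: algebra_simps power2_eq_square)
  have "f = 1 + P * x * (Q - 2 * R + R * (2 + (P * R - P * Q + Q ^ 2) * x) * f
      - P * R ^ 2 * x * f ^ 2) * f"
    (is "f = ?rhs")
  proof -
    \<comment> \<open>The difference is a combination of \<open>f1\<close> and \<open>T1\<close>:
      multiplying \<open>f1\<close> by \<open>1 - R * P * x * f\<close> brings \<open>T\<close> into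
      the form governed by \<open>T1\<close>, so \<open>T\<close> cancels without any
      division.\<close>
    have "f - ?rhs = (f - 1 - x * (P * f * (Q + R * (f - 1)) + Q ^ 2 * T)) * (1 - R * P * x * f)
        + x * Q ^ 2 * (T * (1 - R * P * x * f) - R * P * x * f ^ 2)"
      by (simp add: algebra_simps power2_eq_square)
    also have "\<dots> = 0" using f1 T1 by simp
    finally show ?thesis by simp
  qed
  moreover have "fps_const (q - 2 * r) = Q - 2 * R"
    "fps_const (p * r - p * q + q ^ 2) = P * R - P * Q + Q ^ 2"
    "fps_const (p * r ^ 2) = P * R ^ 2"
    by (simp_all only: P_def Q_def R_def mult_2 power2_eq_square fps_const_add fps_const_sub fps_const_mult)
  ultimately show ?thesis by (simp only: P_def R_def x_def)
qed

end
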